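(* Let $\alpha\in(0,2]$, let $\xi$ be a full-dimensional $S\alpha S$ random vector in $\mathbb{R}^d$ with associated star body $F$, and let $\lambda\in(0,\alpha)$. Then $$\mathbf{E}\|\xi\|^\lambda\ \ge\ 2^\lambda\,\frac{\Gamma(\frac{d+\lambda}{2})}{\Gamma(\frac d2)}\,\frac{\Gamma(1-\frac{\lambda}{\alpha})}{\Gamma(1-\frac{\lambda}{2})}\left(\frac{\kappa_d}{|F|}\right)^{\lambda/d},$$ with equality if and only if $F$ is a (centred) Euclidean ball.
   Context: A random vector $\xi\in\mathbb{R}^d$ is symmetric $\alpha$-stable ($S\alpha S$), $\alpha\in(0,2]$, if $\xi$ has the same distribution as $-\xi$ and $a^{1/\alpha}\xi_1+b^{1/\alpha}\xi_2$ has the same distribution as $(a+b)^{1/\alpha}\xi$ for all $a,b>0$, where $\xi_1,\xi_2$ are independent copies of $\xi$. Its characteristic function can be written as $\mathbf{E}e^{i\langle\xi,u\rangle}=e^{-\|u\|_F^\alpha}$ with $\|u\|_F^\alpha=\int_{\mathbb{S}^{d-1}}|\langle u,z\rangle|^\alpha\sigma(dz)$ for a symmetric finite measure $\sigma$ (the spectral measure) on the Euclidean unit sphere $\mathbb{S}^{d-1}$; the set $F=\{u:\|u\|_F\le1\}$ is the associated star body of $\xi$. $\xi$ is full-dimensional if $\sigma$ is not concentrated on the intersection of $\mathbb{S}^{d-1}$ with a $(d-1)$-dimensional subspace. $|F|$ is the $d$-dimensional Lebesgue measure of $F$, $\kappa_d=\pi^{d/2}/\Gamma(1+\frac d2)$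 is the volume of the Euclidean unit ball, and $\|\cdot\|$ without subscript is the Euclidean norm. *)

theory Defs
  imports "HOL-Probability.Probability"
begin

(* The two coordinates of the product space M \<Otimes> M carry the independent copies of X. *)
definition symmetric_stable :: "real \<Rightarrow> 'b measure \<Rightarrow> ('b \<Rightarrow> 'a::euclidean_space) \<Rightarrow> bool" where
  "symmetric_stable \<alpha> M X \<longleftrightarrow>
     prob_space M \<and> X \<in> borel_measurable M \<and>
     distr M borel X = distr M borel (\<lambda>\<omega>. - X \<omega>) \<and>
     (\<forall>a>0. \<forall>b>0.
        distr (M \<Otimes>\<^sub>M M) borel
          (\<lambda>(\<omega>\<^sub>1, \<omega>\<^sub>2). (a powr (1 / \<alpha>)) *\<^sub>R X \<omega>\<^sub>1 + (b powr (1 / \<alpha>)) *\<^sub>R X \<omega>\<^sub>2)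
        = distr M borel (\<lambda>\<omega>. ((a + b) powr (1 / \<alpha>)) *\<^sub>R X \<omega>))"

definition stable_norm :: "real \<Rightarrow> 'a::euclidean_space measure \<Rightarrow> 'a \<Rightarrow> real" where
  "stable_norm \<alpha> \<sigma> u = (\<integral>z. \<bar>u \<bullet> z\<bar> powr \<alpha> \<partial>\<sigma>) powr (1 / \<alpha>)"

definition star_body :: "real \<Rightarrow> 'a::euclidean_space measure \<Rightarrow> 'a set" where
  "star_body \<alpha> \<sigma> = {u. stable_norm \<alpha> \<sigma> u \<le> 1}"

(* A predicate rather than a function of X: for \<alpha> = 2 the measure is not unique
   (although stable_norm and star_body do not depend on the choice). *)
definition is_spectral_measure ::
    "real \<Rightarrow> 'b measure \<Rightarrow> ('b \<Rightarrow> 'a::euclidean_space) \<Rightarrow> 'a measure \<Rightarrow> bool" where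
  "is_spectral_measure \<alpha> M X \<sigma> \<longleftrightarrow>
     finite_measure \<sigma> \<and> sets \<sigma> = sets (restrict_space borel (sphere 0 1)) \<and>
     distr \<sigma> \<sigma> uminus = \<sigma> \<and>
     (\<forall>u. (CLINT \<omega>|M. iexp (X \<omega> \<bullet> u)) = complex_of_real (exp (- (stable_norm \<alpha> \<sigma> u powr \<alpha>))))"

definition full_dimensional :: "'a::euclidean_space measure \<Rightarrow> bool" where
  "full_dimensional \<sigma> \<longleftrightarrow>
     \<not> (\<exists>S. subspace S \<and> dim S = DIM('a) - 1 \<and> emeasure \<sigma> (sphere 0 1 - S) = 0)"

end

theory Submission imports Defs begin

text \<open>
  Write \<open>N\<close> for the stable norm, so that \<open>F = {N \<le> 1}\<close>, let \<open>d\<close> be the dimension and let \<open>G\<close> be a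
  standard Gaussian vector independent of \<open>\<xi>\<close>. The moment \<open>E |\<xi>|^p\<close> is first turned into the moment
  \<open>E N(G)^p\<close>, which is then bounded from below by a volume comparison.
  
  Averaging the characteristic function of \<open>\<xi>\<close> at \<open>t G\<close> over \<open>G\<close> gives
  \<open>E exp(-t^2 |\<xi>|^2 / 2) = E exp(-t^\<alpha> N(G)^\<alpha>)\<close> (\<open>gaussian_subordination\<close>).
  For \<open>0 < p < a\<close> the integral of \<open>(1 - exp(-t^a A)) t^(-1-p)\<close> over \<open>t > 0\<close> is \<open>A^(p/a) \<Gamma>(1 - p/a) / p\<close>.
  Integrating one minus both sides against \<open>t^(-1-p)\<close>, with \<open>a = 2\<close> on the left and \<open>a = \<alpha>\<close> on the right,
  yields \<open>\<Gamma>(1 - p/2) E |\<xi>|^p = 2^(p/2) \<Gamma>(1 - p/\<alpha>) E N(G)^p\<close>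
  (\<open>absolute_moment_eq_gaussian_moment\<close>). This identity produces the quotient of Gamma values that
  depends on \<open>\<alpha>\<close>, and it shows that the moment is finite.
  
  It remains to see that among all gauges \<open>N\<close> whose unit body has the same volume, the moment
  \<open>E N(G)^p\<close> is smallest for a multiple of the Euclidean norm. A layer-cake decomposition of both
  the Gaussian density and \<open>N^p\<close> expresses it as a positive mixture over \<open>r, s > 0\<close> of the volumes of
  \<open>{|x| \<le> r, N x > s}\<close> (\<open>exp_moment_eq_shell_vol_integral\<close>). Such a set arises from a ball by removing at most
  a copy of \<open>F\<close> scaled by \<open>s\<close>, so its volume is at least the positive part of \<open>\<kappa> r^d - |F| s^d\<close>. For a
  ball \<open>F\<close> the two bodies are nested and this is an equality; the mixture of these positive parts is an
  explicit Gamma integral (\<open>ball_shell_vol_integral\<close>), which supplies the constant.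
  
  If \<open>F\<close> is not a ball, then \<open>N y\<close> differs from \<open>|y| / radius\<close> for some \<open>y\<close>, where \<open>radius\<close> is that of the ball
  of volume \<open>|F|\<close>. By continuity of \<open>N\<close> the two bodies then fail to be nested by a set of positive volume
  for all \<open>(r, s)\<close> in a whole rectangle, and the inequality between the mixtures is strict
  (\<open>exp_moment_greater\<close>).
\<close>


section \<open>One-dimensional integrals\<close>

lemma nn_integral_Gamma:
  assumes "0 < a"
  shows "(\<integral>\<^sup>+v\<in>{0<..}. ennreal (v powr (a - 1) * exp (- v)) \<partial>lborel) = ennreal (Gamma a)"
proof -
  have "((\<lambda>t. t powr (a - 1) / exp t) has_integral Gamma a) {0<..}"
  proof (subst has_integral_spike_set_eq)
    show "negligible {x \<in> {0<..} - {0..}. x powr (a - 1) / exp x \<noteq> 0}"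
      by (rule negligible_subset[of "{0}"]) auto
    show "negligible {x \<in> {0..} - {0<..}. x powr (a - 1) / exp x \<noteq> 0}"
      by (rule negligible_subset[of "{0}"]) auto
  qed (rule Gamma_integral_real[OF assms])
  hence "((\<lambda>t. t powr (a - 1) * exp (- t)) has_integral Gamma a) {0<..}"
    by (simp add: exp_minus field_simps)
  thus ?thesis
    by (intro nn_integral_has_integral_lebesgue') auto
qed

lemma exp_layer_cake:
  fixes a :: real
  shows "ennreal (exp (- a)) = (\<integral>\<^sup>+v. ennreal (exp (- v)) * indicator {a..} v \<partial>lborel)"
proof -
  have "(\<integral>\<^sup>+v. ennreal (exp (- v)) * indicator {a..} v \<partial>lborel) = ennreal (0 - (- exp (- a)))"
  proof (rule nn_integral_FTC_atLeast)
    show "((\<lambda>v. - exp (- v)) \<longlongrightarrow> (0::real)) at_top"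
      using tendsto_minus[OF filterlim_compose[OF exp_at_bot filterlim_uminus_at_bot_at_top]] by simp
  qed (auto intro!: derivative_eq_intros)
  thus ?thesis by simp
qed

lemma one_minus_exp_layer_cake:
  fixes a :: real
  assumes "0 \<le> a"
  shows "ennreal (1 - exp (- a)) = (\<integral>\<^sup>+v. ennreal (exp (- v)) * indicator {0<..a} v \<partial>lborel)"
proof -
  have "(\<integral>\<^sup>+v. ennreal (exp (- v)) * indicator {0..a} v \<partial>lborel) = ennreal (- exp (- a) - (- exp (- 0)))"
    by (rule nn_integral_FTC_Icc) (use assms in \<open>auto intro!: derivative_eq_intros\<close>)
  moreover have "(\<integral>\<^sup>+v. ennreal (exp (- v)) * indicator {0<..a} v \<partial>lborel) =
      (\<integral>\<^sup>+v. ennreal (exp (- v)) * indicator {0..a} v \<partial>lborel)"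
    using AE_lborel_singleton[of "0::real"]
    by (intro nn_integral_cong_AE) (auto simp: indicator_def)
  ultimately show ?thesis by simp
qed

lemma powr_layer_cake:
  fixes y p :: real
  assumes "0 \<le> y" "0 < p"
  shows "ennreal (y powr p) = (\<integral>\<^sup>+s. ennreal (p * s powr (p - 1)) * indicator {0<..<y} s \<partial>lborel)"
proof -
  have "((\<lambda>s. p * s powr (p - 1)) has_integral p * (y powr (p - 1 + 1) / (p - 1 + 1))) {0..y}"
    by (intro has_integral_mult_right has_integral_powr_from_0) (use assms in auto)
  hence "((\<lambda>s. p * s powr (p - 1)) has_integral y powr p) {0<..<y}"
    using assms by (simp add: has_integral_Icc_iff_Ioo)
  thus ?thesis
    using assms by (intro nn_integral_has_integral_lebesgue'[symmetric]) auto
qed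

lemma nn_integral_powr_tail:
  fixes y p :: real
  assumes "0 < y" "0 < p"
  shows "(\<integral>\<^sup>+t. ennreal (t powr (- 1 - p)) * indicator {y..} t \<partial>lborel) = ennreal (y powr (- p) / p)"
proof -
  have "((\<lambda>t. t powr (- 1 - p)) has_integral - (y powr (- 1 - p + 1)) / (- 1 - p + 1)) {y..}"
    by (rule has_integral_powr_to_inf) (use assms in auto)
  thus ?thesis
    using assms by (intro nn_integral_has_integral_lebesgue') (auto simp: field_simps)
qed

text \<open>
  Scaling shows that the integral is a multiple of \<open>A powr (p / a)\<close>. Writing \<open>1 - exp (- t powr a * A)\<close> as the
  mass of the exponential density on \<open>{0<..t powr a * A}\<close> and integrating over \<open>t\<close> first leaves a Gamma
  integral. The condition \<open>p < a\<close> makes it converge at the origin.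
\<close>
lemma nn_integral_one_minus_exp_powr:
  fixes a p A :: real
  assumes p: "0 < p" "p < a" and A: "0 \<le> A"
  shows "(\<integral>\<^sup>+t\<in>{0<..}. ennreal (t powr (- 1 - p)) * ennreal (1 - exp (- (t powr a * A))) \<partial>lborel)
         = ennreal (A powr (p / a) * Gamma (1 - p / a) / p)"
proof (cases "A = 0")
  case False
  with A have A: "0 < A" by simp
  have a: "0 < a" using p by simp
  have iff: "v \<le> t powr a * A \<longleftrightarrow> (v / A) powr (1 / a) \<le> t" if "0 < t" "0 < v" for t v
  proof -
    have "v \<le> t powr a * A \<longleftrightarrow> v / A \<le> t powr a"
      using A by (simp add: field_simps)
    also have "\<dots> \<longleftrightarrow> (v / A) powr (1 / a) \<le> t"
      using powr_mono2[of "1 / a" "v / A" "t powr a"] powr_mono2[of a "(v / A) powr (1 / a)" t] A that a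
      by (auto simp: powr_powr)
    finally show ?thesis .
  qed
  have "(\<integral>\<^sup>+t\<in>{0<..}. ennreal (t powr (- 1 - p)) * ennreal (1 - exp (- (t powr a * A))) \<partial>lborel)
      = (\<integral>\<^sup>+t. \<integral>\<^sup>+v. indicator {0<..} t * ennreal (t powr (- 1 - p)) * (ennreal (exp (- v)) * indicator {0<..t powr a * A} v) \<partial>lborel \<partial>lborel)"
    using A by (intro nn_integral_cong, subst nn_integral_cmult) (simp_all add: one_minus_exp_layer_cake mult_ac)
  also have "\<dots> = (\<integral>\<^sup>+t. \<integral>\<^sup>+v. indicator {0<..} v * ennreal (exp (- v)) * (ennreal (t powr (- 1 - p)) * indicator {(v / A) powr (1 / a)..} t) \<partial>lborel \<partial>lborel)"
  proof (intro nn_integral_cong)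
    fix t v :: real
    have "0 < t" if "0 < v" "(v / A) powr (1 / a) \<le> t"
      using less_le_trans[of 0 "(v / A) powr (1 / a)" t] that A by simp
    thus "indicator {0<..} t * ennreal (t powr (- 1 - p)) * (ennreal (exp (- v)) * indicator {0<..t powr a * A} v) =
      indicator {0<..} v * ennreal (exp (- v)) * (ennreal (t powr (- 1 - p)) * indicator {(v / A) powr (1 / a)..} t)"
      using iff[of t v] by (auto simp: indicator_def mult_ac)
  qed
  also have "\<dots> = (\<integral>\<^sup>+v. \<integral>\<^sup>+t. indicator {0<..} v * ennreal (exp (- v)) * (ennreal (t powr (- 1 - p)) * indicator {(v / A) powr (1 / a)..} t) \<partial>lborel \<partial>lborel)"
    by (rule lborel_pair.Fubini') (simp add: indicator_def[abs_def] case_prod_beta)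
  also have "\<dots> = (\<integral>\<^sup>+v. indicator {0<..} v * ennreal (exp (- v)) * (\<integral>\<^sup>+t. ennreal (t powr (- 1 - p)) * indicator {(v / A) powr (1 / a)..} t \<partial>lborel) \<partial>lborel)"
    by (intro nn_integral_cong nn_integral_cmult) simp
  also have "\<dots> = (\<integral>\<^sup>+v. ennreal (A powr (p / a) / p) * (ennreal (v powr (1 - p / a - 1) * exp (- v)) * indicator {0<..} v) \<partial>lborel)"
  proof (intro nn_integral_cong)
    fix v :: real
    have "((v / A) powr (1 / a)) powr (- p) = A powr (p / a) * v powr (- (p / a))" if "0 < v"
      using that A by (simp add: powr_powr powr_divide powr_minus field_simps)
    thus "indicator {0<..} v * ennreal (exp (- v)) * (\<integral>\<^sup>+t. ennreal (t powr (- 1 - p)) * indicator {(v / A) powr (1 / a)..} t \<partial>lborel)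
        = ennreal (A powr (p / a) / p) * (ennreal (v powr (1 - p / a - 1) * exp (- v)) * indicator {0<..} v)"
      using p A by (cases "0 < v") (simp_all add: nn_integral_powr_tail ennreal_mult'[symmetric] mult_ac)
  qed
  also have "\<dots> = ennreal (A powr (p / a) / p) * ennreal (Gamma (1 - p / a))"
    using p by (subst nn_integral_cmult, simp, subst nn_integral_Gamma) auto
  also have "\<dots> = ennreal (A powr (p / a) * Gamma (1 - p / a) / p)"
    using p by (simp add: ennreal_mult'[symmetric])
  finally show ?thesis .
qed (use p in simp)

section \<open>Gaussian moments of a gauge of given volume\<close>

lemma emeasure_lborel_open_pos:
  fixes U :: "'a::euclidean_space set"
  assumes "open U" "x \<in> U"
  shows "0 < emeasure lborel U"
proof -
  obtain e where e: "0 < e" "ball x e \<subseteq> U"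
    using assms open_contains_ball by blast
  have "0 < emeasure lborel (ball x e)"
    using e by (simp add: emeasure_ball)
  also have "\<dots> \<le> emeasure lborel U"
    using e assms by (intro emeasure_mono) auto
  finally show ?thesis .
qed

lemma nn_integral_strict_mono_interval:
  fixes f g :: "real \<Rightarrow> ennreal"
  assumes [measurable]: "f \<in> borel_measurable lborel" "g \<in> borel_measurable lborel"
    and fin: "(\<integral>\<^sup>+x. f x \<partial>lborel) \<noteq> \<infinity>"
    and le: "\<And>x. f x \<le> g x" and "a < b" and less: "\<And>x. a < x \<Longrightarrow> x < b \<Longrightarrow> f x < g x"
  shows "(\<integral>\<^sup>+x. f x \<partial>lborel) < (\<integral>\<^sup>+x. g x \<partial>lborel)"
proof (rule nn_integral_less[OF _ _ fin])
  show "\<not> (AE x in lborel. g x \<le> f x)"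
  proof
    assume "AE x in lborel. g x \<le> f x"
    hence "AE x in lborel. x \<notin> {a<..<b}"
      by eventually_elim (use less in \<open>auto simp: not_le[symmetric]\<close>)
    hence "emeasure lborel {a<..<b} = 0"
      by (subst (asm) AE_iff_measurable[of "{a<..<b}"]) auto
    thus False using \<open>a < b\<close> by simp
  qed
qed (use le in auto)

lemma unit_ball_vol_DIM_neq_0 [simp]: "unit_ball_vol DIM('a::euclidean_space) \<noteq> 0"
  by (metis less_irrefl of_nat_0_le_iff unit_ball_vol_pos)

text \<open>
  These are the properties of a norm without the triangle inequality, which the stable norm violates in
  general for \<open>\<alpha> < 1\<close>.
\<close>
locale star_gauge =
  fixes N :: "'a::euclidean_space \<Rightarrow> real"
  assumes continuous: "continuous_on UNIV N"
    and nonneg: "0 \<le> N x"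
    and homogeneous: "N (t *\<^sub>R x) = \<bar>t\<bar> * N x"
    and definite: "N x = 0 \<Longrightarrow> x = 0"
begin

definition vol :: real where "vol = measure lborel {x. N x \<le> 1}"

text \<open>
  The volume radius: the radius of the Euclidean ball with the same volume as the unit body of \<open>N\<close>.
\<close>
definition radius :: real where "radius = (vol / unit_ball_vol DIM('a)) powr (1 / DIM('a))"

lemma measurable_gauge [measurable]: "N \<in> borel_measurable borel"
  using continuous by (rule borel_measurable_continuous_onI)

lemma gauge_zero [simp]: "N 0 = 0"
  using homogeneous[of 0 0] by simp

lemma ge_norm: "\<exists>m>0. \<forall>x. m * norm x \<le> N x"
proof -
  obtain b :: 'a where b: "b \<in> Basis" using nonempty_Basis by blast
  have "continuous_on (sphere 0 1) N"
    using continuous continuous_on_subset by blast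
  moreover have "sphere (0::'a) 1 \<noteq> {}" using b by (auto simp: norm_Basis intro!: exI[of _ b])
  ultimately obtain x0 where x0: "x0 \<in> sphere 0 1" "\<And>x. x \<in> sphere 0 1 \<Longrightarrow> N x0 \<le> N x"
    using continuous_attains_inf[of "sphere 0 1" N] by auto
  have "N x0 * norm x \<le> N x" for x
  proof (cases "x = 0")
    case False
    have "N x = norm x * N (x /\<^sub>R norm x)"
      using homogeneous[of "norm x" "x /\<^sub>R norm x"] False by simp
    moreover have "N x0 \<le> N (x /\<^sub>R norm x)" using False by (intro x0) simp
    ultimately show ?thesis using mult_right_mono[of "N x0" "N (x /\<^sub>R norm x)" "norm x"] by (simp add: mult.commute)
  qed simp
  moreover have "0 < N x0"
    using x0(1) nonneg[of x0] definite[of x0] by fastforce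
  ultimately show ?thesis by blast
qed

lemma emeasure_sublevel_finite: "emeasure lborel {x. N x \<le> s} < \<infinity>"
proof -
  obtain m where m: "m > 0" "\<And>x. m * norm x \<le> N x" using ge_norm by blast
  have "{x. N x \<le> s} \<subseteq> cball 0 (s / m)"
  proof
    fix x assume "x \<in> {x. N x \<le> s}"
    with m(2)[of x] have "m * norm x \<le> s" by simp
    thus "x \<in> cball 0 (s / m)" using m(1) by (simp add: field_simps)
  qed
  thus ?thesis using bounded_subset bounded_cball emeasure_bounded_finite by metis
qed

lemma open_strict_sublevel: "open {x. N x < s}" "open {x. s < N x}"
  using continuous by (auto intro!: open_Collect_less continuous_intros)

lemma vol_pos: "0 < vol"
proof -
  have "0 < emeasure lborel {x. N x < 1}"
    by (rule emeasure_lborel_open_pos[of _ 0]) (simp_all add: open_strict_sublevel)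
  also have "\<dots> \<le> emeasure lborel {x. N x \<le> 1}"
    by (intro emeasure_mono) auto
  finally show ?thesis
    using emeasure_sublevel_finite[of 1] by (simp add: vol_def measure_def enn2real_positive_iff)
qed

lemma radius_pos: "0 < radius"
  using vol_pos by (simp add: radius_def)

lemma vol_eq: "vol = unit_ball_vol DIM('a) * radius ^ DIM('a)"
proof -
  have "radius ^ DIM('a) = radius powr DIM('a)"
    using radius_pos by (simp add: powr_realpow)
  also have "\<dots> = vol / unit_ball_vol DIM('a)"
    using vol_pos by (simp add: radius_def powr_powr)
  finally show ?thesis by simp
qed

lemma emeasure_sublevel:
  assumes "0 < s"
  shows "emeasure lborel {x. N x \<le> s} = ennreal (vol * s ^ DIM('a))"
proof -
  have "emeasure lborel {x. N x \<le> s}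
      = emeasure (density (distr lborel borel (\<lambda>x. 0 + s *\<^sub>R x)) (\<lambda>_. ennreal (\<bar>s\<bar> ^ DIM('a)))) {x. N x \<le> s}"
    using lborel_affine[of s "0::'a"] assms by simp
  also have "\<dots> = ennreal (s ^ DIM('a)) * emeasure lborel ((\<lambda>x. s *\<^sub>R x) -` {x. N x \<le> s})"
    using assms by (simp add: emeasure_density_const emeasure_distr)
  also have "(\<lambda>x. s *\<^sub>R x) -` {x. N x \<le> s} = {x. N x \<le> 1}"
    using assms by (auto simp: homogeneous)
  also have "emeasure lborel {x. N x \<le> 1} = ennreal vol"
    using emeasure_sublevel_finite[of 1] by (simp add: vol_def emeasure_eq_ennreal_measure)
  finally show ?thesis using assms vol_pos by (simp add: ennreal_mult mult.commute)
qed

text \<open>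
  The gauge enters the moments only through the volume that remains of a Euclidean ball of radius \<open>r\<close>
  after removing a sublevel set. Its counterpart \<open>ball_shell_vol\<close> is what would remain if the smaller of the two
  bodies were contained in the larger one; the truncation of negative numbers by \<open>ennreal\<close>
  accounts for the case that nothing remains.
\<close>
definition shell_vol :: "real \<Rightarrow> real \<Rightarrow> ennreal" where
  "shell_vol r s = emeasure lborel {x. norm x \<le> r \<and> s < N x}"

definition ball_shell_vol :: "real \<Rightarrow> real \<Rightarrow> ennreal" where
  "ball_shell_vol r s = ennreal (unit_ball_vol DIM('a) * r ^ DIM('a) - vol * s ^ DIM('a))"

lemma measurable_shell_vol [measurable]: "case_prod shell_vol \<in> borel_measurable (borel \<Otimes>\<^sub>M borel)"
proof -
  have "case_prod shell_vol = (\<lambda>z. \<integral>\<^sup>+x. indicator {x. norm x \<le> fst z \<and> snd z < N x} x \<partial>lborel)"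
    by (auto simp: shell_vol_def fun_eq_iff)
  thus ?thesis
    by (simp add: indicator_def)
qed

lemma measurable_ball_shell_vol [measurable]: "case_prod ball_shell_vol \<in> borel_measurable (borel \<Otimes>\<^sub>M borel)"
  unfolding ball_shell_vol_def by measurable

text \<open>
  The excess over \<open>ball_shell_vol\<close> is the volume of the part of the sublevel set that sticks out of the ball.
  This gives the inequality at once and isolates what has to be positive for it to be strict.
\<close>
lemma shell_vol_decomposition:
  assumes "0 \<le> r" "0 < s"
  shows "shell_vol r s = ennreal (unit_ball_vol DIM('a) * r ^ DIM('a) - vol * s ^ DIM('a)
                     + measure lborel {x. r < norm x \<and> N x \<le> s})"
proof -
  let ?B = "cball (0::'a) r" and ?F = "{x. N x \<le> s}"
  have [measurable]: "?B \<in> sets borel" "?F \<in> sets borel" by auto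
  have fin: "?B \<in> fmeasurable lborel" "?F \<in> fmeasurable lborel"
    using emeasure_sublevel_finite[of s] by (auto simp: fmeasurable_def emeasure_cball assms)
  have "measure lborel (?B - ?F) = measure lborel ?B - measure lborel (?B \<inter> ?F)"
    using measurable_measure_Diff[of ?B lborel "?B \<inter> ?F"] fin by (simp add: Diff_Int)
  moreover have "measure lborel (?F - ?B) = measure lborel ?F - measure lborel (?B \<inter> ?F)"
    using measurable_measure_Diff[of ?F lborel "?B \<inter> ?F"] fin by (simp add: Diff_Int)
  moreover have "measure lborel ?B = unit_ball_vol DIM('a) * r ^ DIM('a)"
    using assms by (simp add: content_cball)
  moreover have "measure lborel ?F = vol * s ^ DIM('a)"
    using assms vol_pos by (simp add: measure_def emeasure_sublevel)
  moreover have "shell_vol r s = ennreal (measure lborel (?B - ?F))"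
  proof -
    have "?B - ?F = {x. norm x \<le> r \<and> s < N x}" by auto
    moreover have "emeasure lborel (?B - ?F) = ennreal (measure lborel (?B - ?F))"
      using fmeasurable.Diff[OF fin] by (simp add: emeasure_eq_measure2)
    ultimately show ?thesis by (simp add: shell_vol_def)
  qed
  moreover have "?F - ?B = {x. r < norm x \<and> N x \<le> s}" by auto
  ultimately show ?thesis by simp
qed

lemma ball_shell_vol_le_shell_vol:
  assumes "0 \<le> r" "0 < s"
  shows "ball_shell_vol r s \<le> shell_vol r s"
  using assms by (simp add: ball_shell_vol_def shell_vol_decomposition ennreal_leI)

text \<open>
  If the sublevel set has the smaller volume, a point of its interior outside the closed ball makes the
  inequality strict, because a whole neighbourhood of that point sticks out.
\<close>
lemma ball_shell_vol_less_shell_vol_if_outside: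
  assumes "0 \<le> r" "0 < s" "radius * s \<le> r" "r < norm y" "N y < s"
  shows "ball_shell_vol r s < shell_vol r s"
proof -
  let ?D = "{x. r < norm x \<and> N x \<le> s}"
  have "open ({x. r < norm x} \<inter> {x. N x < s})"
    by (intro open_Int open_strict_sublevel open_Collect_less continuous_intros)
  hence "0 < emeasure lborel ({x. r < norm x} \<inter> {x. N x < s})"
    by (rule emeasure_lborel_open_pos[of _ y]) (use assms in auto)
  also have "\<dots> \<le> emeasure lborel ?D"
    by (intro emeasure_mono) auto
  finally have pos: "0 < emeasure lborel ?D" .
  have "emeasure lborel ?D \<le> emeasure lborel {x. N x \<le> s}"
    by (intro emeasure_mono) auto
  hence "0 < measure lborel ?D"
    using pos emeasure_sublevel_finite[of s] by (simp add: measure_def enn2real_positive_iff)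
  moreover have "(radius * s) ^ DIM('a) \<le> r ^ DIM('a)"
    using assms radius_pos by (intro power_mono) auto
  hence "vol * s ^ DIM('a) \<le> unit_ball_vol DIM('a) * r ^ DIM('a)"
    by (simp add: vol_eq power_mult_distrib mult_left_mono mult.assoc)
  ultimately show ?thesis
    using assms by (simp add: ball_shell_vol_def shell_vol_decomposition ennreal_less_iff)
qed

text \<open>
  In the opposite volume regime \<open>ball_shell_vol\<close> vanishes, so a neighbourhood inside the ball that is missed by the
  sublevel set suffices.
\<close>
lemma ball_shell_vol_less_shell_vol_if_inside:
  assumes "0 \<le> r" "r \<le> radius * s" "norm y < r" "s < N y"
  shows "ball_shell_vol r s < shell_vol r s"
proof -
  have "open ({x. norm x < r} \<inter> {x. s < N x})"
    by (intro open_Int open_strict_sublevel open_Collect_less continuous_intros)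
  hence "0 < emeasure lborel ({x. norm x < r} \<inter> {x. s < N x})"
    by (rule emeasure_lborel_open_pos[of _ y]) (use assms in auto)
  also have "\<dots> \<le> shell_vol r s"
    unfolding shell_vol_def by (intro emeasure_mono) auto
  finally have "0 < shell_vol r s" .
  moreover have "r ^ DIM('a) \<le> (radius * s) ^ DIM('a)"
    using assms by (intro power_mono) auto
  hence "unit_ball_vol DIM('a) * r ^ DIM('a) \<le> vol * s ^ DIM('a)"
    by (simp add: vol_eq power_mult_distrib mult_left_mono mult.assoc)
  hence "ball_shell_vol r s = 0" by (simp add: ball_shell_vol_def ennreal_neg)
  ultimately show ?thesis by simp
qed

text \<open>
  A point where \<open>N\<close> is too small gives strictness for balls larger than the sublevel set, a point where
  \<open>N\<close> is too large gives it for smaller ones. Either way the admissible \<open>(r, s)\<close> contain a rectangle, which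
  has positive measure.
\<close>
lemma ball_shell_vol_less_shell_vol_rectangle:
  assumes "N y \<noteq> norm y / radius"
  obtains r1 r2 s1 s2 where "0 \<le> r1" "r1 < r2" "0 \<le> s1" "s1 < s2"
    "\<And>r s. r1 < r \<Longrightarrow> r < r2 \<Longrightarrow> s1 < s \<Longrightarrow> s < s2 \<Longrightarrow> ball_shell_vol r s < shell_vol r s"
proof (cases "N y < norm y / radius")
  case True
  then obtain s2 where s2: "N y < s2" "s2 < norm y / radius" using dense by blast
  have pos: "0 < s2" using s2 nonneg[of y] by simp
  show ?thesis
  proof
    show "0 \<le> radius * s2" "0 \<le> N y" using pos radius_pos nonneg by simp_all
    show "radius * s2 < norm y" "N y < s2" using s2 radius_pos by (simp_all add: field_simps)
    fix r s assume rs: "radius * s2 < r" "r < norm y" "N y < s" "s < s2"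
    have "radius * s \<le> radius * s2" using rs radius_pos by simp
    moreover have "0 < s" using rs nonneg[of y] by simp
    moreover have "0 \<le> r" using rs pos radius_pos by (meson less_imp_le mult_pos_pos order.strict_trans)
    ultimately show "ball_shell_vol r s < shell_vol r s"
      using rs by (intro ball_shell_vol_less_shell_vol_if_outside[of r s y]) auto
  qed
next
  case False
  with assms have "norm y / radius < N y" by simp
  then obtain s1 where s1: "norm y / radius < s1" "s1 < N y" using dense by blast
  have pos: "0 < s1" using s1 radius_pos by (meson divide_nonneg_pos norm_ge_zero order.strict_trans1)
  show ?thesis
  proof
    show "0 \<le> norm y" "0 \<le> s1" "s1 < N y" using pos s1 by simp_all
    show "norm y < radius * s1" using s1 radius_pos by (simp add: field_simps)
    fix r s assume rs: "norm y < r" "r < radius * s1" "s1 < s" "s < N y"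
    have "radius * s1 \<le> radius * s" using rs radius_pos by simp
    moreover have "0 \<le> r" using rs norm_ge_zero[of y] by linarith
    ultimately show "ball_shell_vol r s < shell_vol r s"
      using rs by (intro ball_shell_vol_less_shell_vol_if_inside[of r s y]) auto
  qed
qed

lemma shell_vol_eq_ball_shell_vol:
  assumes "\<And>x. N x = norm x / radius" "0 \<le> r" "0 < s"
  shows "shell_vol r s = ball_shell_vol r s"
proof (cases "radius * s \<le> r")
  case True
  moreover have "norm x \<le> radius * s" if "N x \<le> s" for x
    using that assms(1)[of x] radius_pos by (simp add: field_simps)
  ultimately have empty: "{x. r < norm x \<and> N x \<le> s} = {}" by fastforce
  show ?thesis using assms(2,3) unfolding shell_vol_decomposition[OF assms(2,3)] ball_shell_vol_def empty by simp
next
  case False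
  have empty: "{x. norm x \<le> r \<and> s < N x} = {}"
  proof (safe, goal_cases)
    case (1 x)
    hence "s * radius < norm x" using assms(1)[of x] radius_pos by (simp add: field_simps)
    thus ?case using 1 False by (simp add: mult.commute)
  qed
  have "ball_shell_vol r s \<le> shell_vol r s" using assms by (intro ball_shell_vol_le_shell_vol)
  thus ?thesis unfolding shell_vol_def empty by simp
qed


text \<open>
  The weight \<open>exp (- |x|^2 / 2)\<close> is the exponential mass of all \<open>v \<ge> |x|^2 / 2\<close>, that is, of all \<open>v\<close> for which \<open>x\<close>
  lies in the ball of radius \<open>sqrt (2 * v)\<close>; and \<open>N x powr p\<close> is the integral of the density \<open>p * s powr (p - 1)\<close> over
  \<open>0 < s < N x\<close>. Exchanging integrals leaves the volume of the set of \<open>x\<close> that satisfy both conditions.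
\<close>
lemma exp_moment_eq_shell_vol_integral:
  fixes p :: real
  assumes p: "0 < p"
  shows "(\<integral>\<^sup>+x. ennreal (exp (- (norm x)\<^sup>2 / 2) * N x powr p) \<partial>lborel)
       = (\<integral>\<^sup>+v\<in>{0<..}. ennreal (exp (- v)) *
            (\<integral>\<^sup>+s\<in>{0<..}. ennreal (p * s powr (p - 1)) * shell_vol (sqrt (2 * v)) s \<partial>lborel) \<partial>lborel)"
proof -
  define E :: "real \<Rightarrow> ennreal" where "E v = ennreal (exp (- v)) * indicator {0<..} v" for v
  \<comment> \<open>The three factors of the integrand: exponential weight, radial weight, and the joint condition on \<open>x\<close>.\<close>
  define W where "W s = ennreal (p * s powr (p - 1)) * indicator {0<..} s" for s
  define I :: "'a \<Rightarrow> real \<Rightarrow> real \<Rightarrow> ennreal"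
    where "I x v s = (if norm x \<le> sqrt (2 * v) \<and> s < N x then 1 else 0)" for x v s
  have [measurable]: "E \<in> borel_measurable borel" "W \<in> borel_measurable borel"
    unfolding E_def W_def by measurable
  have [measurable]: "(\<lambda>z. I (f z) (g z) (h z)) \<in> borel_measurable M"
    if [measurable]: "f \<in> borel_measurable M" "g \<in> borel_measurable M" "h \<in> borel_measurable M"
    for f g h and M :: "'z measure"
    unfolding I_def by measurable
  have split: "ennreal (exp (- (norm x)\<^sup>2 / 2) * N x powr p) = (\<integral>\<^sup>+v. \<integral>\<^sup>+s. E v * (W s * I x v s) \<partial>lborel \<partial>lborel)" for x
  proof -
    have "ennreal (exp (- (norm x)\<^sup>2 / 2)) = (\<integral>\<^sup>+v. ennreal (exp (- v)) * indicator {(norm x)\<^sup>2 / 2..} v \<partial>lborel)"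
      using exp_layer_cake[of "(norm x)\<^sup>2 / 2"] by simp
    also have "\<dots> = (\<integral>\<^sup>+v. E v * indicator {(norm x)\<^sup>2 / 2..} v \<partial>lborel)"
    proof (rule nn_integral_cong_AE)
      have "ennreal (exp (- v)) * indicator {(norm x)\<^sup>2 / 2..} v = E v * indicator {(norm x)\<^sup>2 / 2..} v"
        if "v \<noteq> 0" for v
      proof (cases "(norm x)\<^sup>2 / 2 \<le> v")
        case True
        hence "0 < v" using that zero_le_power2[of "norm x"] by linarith
        thus ?thesis by (simp add: E_def)
      qed simp
      thus "AE v in lborel. ennreal (exp (- v)) * indicator {(norm x)\<^sup>2 / 2..} v = E v * indicator {(norm x)\<^sup>2 / 2..} v"
        by (rule eventually_mono[OF AE_lborel_singleton[of "0::real"]])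
    qed
    finally have "ennreal (exp (- (norm x)\<^sup>2 / 2) * N x powr p)
      = (\<integral>\<^sup>+v. E v * indicator {(norm x)\<^sup>2 / 2..} v * ennreal (N x powr p) \<partial>lborel)"
      by (simp add: ennreal_mult' nn_integral_multc)
    also have "\<dots> = (\<integral>\<^sup>+v. \<integral>\<^sup>+s. E v * (W s * I x v s) \<partial>lborel \<partial>lborel)"
    proof (intro nn_integral_cong)
      fix v
      have iff: "norm x \<le> sqrt (2 * v) \<longleftrightarrow> (norm x)\<^sup>2 / 2 \<le> v"
        using real_sqrt_le_iff[of "(norm x)\<^sup>2" "2 * v"] by (simp add: mult.commute)
      have "E v * indicator {(norm x)\<^sup>2 / 2..} v * ennreal (N x powr p)
          = (\<integral>\<^sup>+s. E v * indicator {(norm x)\<^sup>2 / 2..} v * (ennreal (p * s powr (p - 1)) * indicator {0<..<N x} s) \<partial>lborel)"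
        using powr_layer_cake[OF nonneg p] by (subst nn_integral_cmult) simp_all
      also have "\<dots> = (\<integral>\<^sup>+s. E v * (W s * I x v s) \<partial>lborel)"
        unfolding W_def I_def iff
        by (intro nn_integral_cong) (auto simp: indicator_def)
      finally show "E v * indicator {(norm x)\<^sup>2 / 2..} v * ennreal (N x powr p)
          = (\<integral>\<^sup>+s. E v * (W s * I x v s) \<partial>lborel)" .
    qed
    finally show ?thesis .
  qed
  have shell_vol: "shell_vol (sqrt (2 * v)) s = (\<integral>\<^sup>+x. I x v s \<partial>lborel)" for v s
  proof -
    have "(\<integral>\<^sup>+x. I x v s \<partial>lborel) = (\<integral>\<^sup>+x. indicator {x. norm x \<le> sqrt (2 * v) \<and> s < N x} x \<partial>lborel)"
      by (intro nn_integral_cong) (auto simp: I_def)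
    thus ?thesis by (simp add: shell_vol_def)
  qed
  have "(\<integral>\<^sup>+x. ennreal (exp (- (norm x)\<^sup>2 / 2) * N x powr p) \<partial>lborel)
      = (\<integral>\<^sup>+x. \<integral>\<^sup>+v. \<integral>\<^sup>+s. E v * (W s * I x v s) \<partial>lborel \<partial>lborel \<partial>lborel)"
    by (simp only: split)
  also have "\<dots> = (\<integral>\<^sup>+v. \<integral>\<^sup>+x. \<integral>\<^sup>+s. E v * (W s * I x v s) \<partial>lborel \<partial>lborel \<partial>lborel)"
    by (rule lborel_pair.Fubini') measurable
  also have "\<dots> = (\<integral>\<^sup>+v. \<integral>\<^sup>+s. \<integral>\<^sup>+x. E v * (W s * I x v s) \<partial>lborel \<partial>lborel \<partial>lborel)"
    by (intro nn_integral_cong lborel_pair.Fubini') measurable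
  also have "\<dots> = (\<integral>\<^sup>+v. E v * (\<integral>\<^sup>+s. W s * (\<integral>\<^sup>+x. I x v s \<partial>lborel) \<partial>lborel) \<partial>lborel)"
    by (simp add: nn_integral_cmult)
  finally show ?thesis
    unfolding shell_vol by (simp add: E_def W_def mult_ac)
qed

text \<open>
  The integrand vanishes beyond \<open>s = r / radius\<close>, where the two bodies have equal volume; below that
  point it is a difference of two powers of \<open>s\<close>.
\<close>
lemma nn_integral_ball_shell_vol:
  fixes p r :: real
  assumes p: "0 < p" and r: "0 < r"
  shows "(\<integral>\<^sup>+s\<in>{0<..}. ennreal (p * s powr (p - 1)) * ball_shell_vol r s \<partial>lborel)
       = ennreal (unit_ball_vol DIM('a) * DIM('a) / (DIM('a) + p) * radius powr (- p) * r powr (DIM('a) + p))"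
proof -
  let ?d = "real DIM('a)" and ?k = "unit_ball_vol DIM('a)"
  \<comment> \<open>The sublevel set of height \<open>R\<close> has the volume of the ball of radius \<open>r\<close>.\<close>
  define R where "R = r / radius"
  have R: "0 < R" using r radius_pos by (simp add: R_def)
  have rR: "r = radius * R" using radius_pos by (simp add: R_def)
  have "((\<lambda>s. p * ?k * r ^ DIM('a) * s powr (p - 1) - p * vol * s powr (?d + p - 1)) has_integral
      (p * ?k * r ^ DIM('a) * (R powr (p - 1 + 1) / (p - 1 + 1))
        - p * vol * (R powr (?d + p - 1 + 1) / (?d + p - 1 + 1)))) {0..R}"
    by (intro has_integral_diff has_integral_mult_right has_integral_powr_from_0) (use p R in auto)
  also have "p * ?k * r ^ DIM('a) * (R powr (p - 1 + 1) / (p - 1 + 1))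
        - p * vol * (R powr (?d + p - 1 + 1) / (?d + p - 1 + 1))
      = ?k * ?d / (?d + p) * radius powr (- p) * r powr (?d + p)"
  proof -
    define x where "x = ?k * (radius powr ?d * R powr ?d * R powr p)"
    have dp: "?d + p > 0" using p by (simp add: add_nonneg_pos)
    have frac: "1 - p / (?d + p) = ?d / (?d + p)"
      using dp by (simp add: field_simps)
    have rp: "r powr (?d + p) = radius powr ?d * radius powr p * (R powr ?d * R powr p)"
      using R radius_pos by (simp add: rR powr_mult powr_add)
    have inv: "radius powr (- p) * radius powr p = 1"
      using radius_pos by (simp add: powr_add[symmetric])
    have "r ^ DIM('a) = radius powr ?d * R powr ?d"
      using R radius_pos by (simp add: rR powr_realpow[symmetric] powr_mult)
    hence "p * ?k * r ^ DIM('a) * (R powr (p - 1 + 1) / (p - 1 + 1)) = x"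
      using p by (simp add: x_def)
    moreover have "vol = ?k * radius powr ?d" using radius_pos by (simp add: vol_eq powr_realpow)
    hence "p * vol * (R powr (?d + p - 1 + 1) / (?d + p - 1 + 1)) = x * (p / (?d + p))"
      by (simp add: x_def powr_add)
    ultimately have "p * ?k * r ^ DIM('a) * (R powr (p - 1 + 1) / (p - 1 + 1))
        - p * vol * (R powr (?d + p - 1 + 1) / (?d + p - 1 + 1)) = x * (1 - p / (?d + p))"
      by (simp only: right_diff_distrib mult_1_right)
    also have "\<dots> = x * (?d / (?d + p)) * (radius powr (- p) * radius powr p)"
      by (simp only: frac inv mult_1_right)
    also have "\<dots> = ?k * ?d / (?d + p) * radius powr (- p) * r powr (?d + p)"
      unfolding rp x_def by (simp only: times_divide_eq_left times_divide_eq_right mult_ac)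
    finally show ?thesis .
  qed
  finally have "((\<lambda>s. p * s powr (p - 1) * (?k * r ^ DIM('a) - vol * s ^ DIM('a))) has_integral
      ?k * ?d / (?d + p) * radius powr (- p) * r powr (?d + p)) {0<..<R}"
    unfolding has_integral_Icc_iff_Ioo
    by (rule has_integral_eq[rotated])
       (auto simp: algebra_simps powr_realpow[symmetric] powr_add[symmetric])
  moreover have "vol * s ^ DIM('a) \<le> ?k * r ^ DIM('a)" if "0 < s" "s < R" for s
  proof -
    have "(radius * s) ^ DIM('a) \<le> r ^ DIM('a)"
      using that radius_pos by (intro power_mono) (auto simp: rR)
    thus ?thesis by (simp add: vol_eq power_mult_distrib mult_left_mono mult.assoc)
  qed
  ultimately have "(\<integral>\<^sup>+s. ennreal (p * s powr (p - 1) * (?k * r ^ DIM('a) - vol * s ^ DIM('a))) * indicator {0<..<R} s \<partial>lborel)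
     = ennreal (?k * ?d / (?d + p) * radius powr (- p) * r powr (?d + p))"
    using p by (intro nn_integral_has_integral_lebesgue') auto
  moreover have "ball_shell_vol r s = 0" if "R \<le> s" for s
  proof -
    have "r ^ DIM('a) \<le> (radius * s) ^ DIM('a)"
      using that radius_pos r by (intro power_mono) (auto simp: rR)
    thus ?thesis by (simp add: ball_shell_vol_def ennreal_neg vol_eq power_mult_distrib mult_left_mono mult.assoc)
  qed
  hence "(\<integral>\<^sup>+s\<in>{0<..}. ennreal (p * s powr (p - 1)) * ball_shell_vol r s \<partial>lborel)
      = (\<integral>\<^sup>+s. ennreal (p * s powr (p - 1) * (?k * r ^ DIM('a) - vol * s ^ DIM('a))) * indicator {0<..<R} s \<partial>lborel)"
    using p by (intro nn_integral_cong) (auto simp: indicator_def ennreal_mult' ball_shell_vol_def not_less)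
  ultimately show ?thesis by simp
qed

lemma ball_shell_vol_integral:
  fixes p :: real
  assumes p: "0 < p"
  shows "(\<integral>\<^sup>+v\<in>{0<..}. ennreal (exp (- v)) *
            (\<integral>\<^sup>+s\<in>{0<..}. ennreal (p * s powr (p - 1)) * ball_shell_vol (sqrt (2 * v)) s \<partial>lborel) \<partial>lborel)
       = ennreal ((2 * pi) powr (DIM('a) / 2) *
           (2 powr (p / 2) * (Gamma ((DIM('a) + p) / 2) / Gamma (DIM('a) / 2)) * radius powr (- p)))"
proof -
  let ?d = "real DIM('a)" and ?k = "unit_ball_vol DIM('a)"
  define q where "q = (?d + p) / 2"
  have d: "0 < ?d" by simp
  have q: "0 < q" using p by (simp add: q_def add_nonneg_pos)
  define C where "C = ?k * ?d / (?d + p) * radius powr (- p) * 2 powr q"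
  have C: "0 \<le> C" using p by (simp add: C_def)
  have "(\<integral>\<^sup>+v\<in>{0<..}. ennreal (exp (- v)) *
            (\<integral>\<^sup>+s\<in>{0<..}. ennreal (p * s powr (p - 1)) * ball_shell_vol (sqrt (2 * v)) s \<partial>lborel) \<partial>lborel)
      = (\<integral>\<^sup>+v. ennreal C * (ennreal (v powr (q + 1 - 1) * exp (- v)) * indicator {0<..} v) \<partial>lborel)"
  proof (intro nn_integral_cong)
    fix v :: real
    have "sqrt (2 * v) powr (?d + p) = 2 powr q * v powr q" if "0 < v"
      using that by (simp add: q_def powr_half_sqrt[symmetric] powr_powr powr_mult)
    moreover have "(\<integral>\<^sup>+s\<in>{0<..}. ennreal (p * s powr (p - 1)) * ball_shell_vol (sqrt (2 * v)) s \<partial>lborel)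
        = ennreal (?k * ?d / (?d + p) * radius powr (- p) * sqrt (2 * v) powr (?d + p))" if "0 < v"
      using that by (intro nn_integral_ball_shell_vol[OF p]) simp
    ultimately show "ennreal (exp (- v)) *
            (\<integral>\<^sup>+s\<in>{0<..}. ennreal (p * s powr (p - 1)) * ball_shell_vol (sqrt (2 * v)) s \<partial>lborel) * indicator {0<..} v
      = ennreal C * (ennreal (v powr (q + 1 - 1) * exp (- v)) * indicator {0<..} v)"
      using C by (cases "0 < v") (simp_all add: ennreal_mult'[symmetric] C_def mult_ac)
  qed
  also have "\<dots> = ennreal (C * Gamma (q + 1))"
    using C q by (subst nn_integral_cmult, simp, subst nn_integral_Gamma) (auto simp: ennreal_mult')
  also have "C * Gamma (q + 1) = (2 * pi) powr (?d / 2) *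
           (2 powr (p / 2) * (Gamma ((?d + p) / 2) / Gamma (?d / 2)) * radius powr (- p))"
  proof -
    have "Gamma (q + 1) = q * Gamma q" using q by (intro Gamma_plus1) (auto dest: nonpos_Ints_nonpos)
    moreover have "?d / (?d + p) * q = ?d / 2" using p d by (simp add: q_def field_simps)
    moreover have "C * (q * Gamma q) = ?k * (?d / (?d + p) * q) * radius powr (- p) * 2 powr q * Gamma q"
      unfolding C_def by (simp only: times_divide_eq_left times_divide_eq_right mult_ac)
    ultimately have "C * Gamma (q + 1) = ?k * (?d / 2) * radius powr (- p) * 2 powr q * Gamma q"
      by (simp only:)
    also have "?k * (?d / 2) = pi powr (?d / 2) / Gamma (?d / 2)"
    proof -
      have "Gamma (?d / 2 + 1) = ?d / 2 * Gamma (?d / 2)"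
        using d by (intro Gamma_plus1) (auto dest: nonpos_Ints_nonpos)
      moreover have "Gamma (?d / 2) > 0" by (rule Gamma_real_pos) simp
      ultimately show ?thesis by (simp add: unit_ball_vol_def)
    qed
    also have "2 powr q = 2 powr (?d / 2) * 2 powr (p / 2)"
      by (simp add: q_def powr_add[symmetric] add_divide_distrib)
    finally show ?thesis by (simp add: q_def powr_mult)
  qed
  finally show ?thesis .
qed

text \<open>
  Both moments omit the normalising factor \<open>(2 * pi) powr (- d / 2)\<close> of the Gaussian density; the factor
  \<open>(2 * pi) powr (d / 2)\<close> in \<open>ball_exp_moment\<close> compensates for this.
\<close>
abbreviation exp_moment :: "real \<Rightarrow> ennreal" where
  "exp_moment p \<equiv> (\<integral>\<^sup>+x. ennreal (exp (- (norm x)\<^sup>2 / 2) * N x powr p) \<partial>lborel)"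

abbreviation ball_exp_moment :: "real \<Rightarrow> real" where
  "ball_exp_moment p \<equiv> (2 * pi) powr (DIM('a) / 2) *
     (2 powr (p / 2) * (Gamma ((real DIM('a) + p) / 2) / Gamma (DIM('a) / 2)) * radius powr (- p))"

lemma exp_moment_ge:
  assumes p: "0 < p"
  shows "ennreal (ball_exp_moment p) \<le> exp_moment p"
  unfolding exp_moment_eq_shell_vol_integral[OF p] ball_shell_vol_integral[OF p, symmetric]
  by (intro nn_integral_mono) (auto simp: indicator_def intro!: mult_left_mono nn_integral_mono ball_shell_vol_le_shell_vol)

lemma exp_moment_ball:
  assumes p: "0 < p" and "\<And>x. N x = norm x / radius"
  shows "exp_moment p = ennreal (ball_exp_moment p)"
  unfolding exp_moment_eq_shell_vol_integral[OF p] ball_shell_vol_integral[OF p, symmetric]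
proof (intro nn_integral_cong)
  fix v :: real
  have "(\<integral>\<^sup>+s\<in>{0<..}. ennreal (p * s powr (p - 1)) * shell_vol (sqrt (2 * v)) s \<partial>lborel)
      = (\<integral>\<^sup>+s\<in>{0<..}. ennreal (p * s powr (p - 1)) * ball_shell_vol (sqrt (2 * v)) s \<partial>lborel)" if "0 < v"
    using that by (intro nn_integral_cong) (simp add: indicator_def shell_vol_eq_ball_shell_vol[OF assms(2)])
  thus "ennreal (exp (- v)) *
          (\<integral>\<^sup>+s\<in>{0<..}. ennreal (p * s powr (p - 1)) * shell_vol (sqrt (2 * v)) s \<partial>lborel) * indicator {0<..} v
      = ennreal (exp (- v)) *
          (\<integral>\<^sup>+s\<in>{0<..}. ennreal (p * s powr (p - 1)) * ball_shell_vol (sqrt (2 * v)) s \<partial>lborel) * indicator {0<..} v"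
    by (cases "0 < v") simp_all
qed

text \<open>
  The inequality between the two iterated integrals is strict on a rectangle, so it is strict after the inner
  integration for \<open>v\<close> in an interval, and hence after the outer one. Finiteness of the smaller
  integral is needed at both stages.
\<close>
lemma exp_moment_greater:
  assumes p: "0 < p" and y: "N y \<noteq> norm y / radius"
  shows "ennreal (ball_exp_moment p) < exp_moment p"
proof -
  obtain r1 r2 s1 s2 where r: "0 \<le> r1" "r1 < r2" and s: "0 \<le> s1" "s1 < s2"
    and less: "\<And>r s. r1 < r \<Longrightarrow> r < r2 \<Longrightarrow> s1 < s \<Longrightarrow> s < s2 \<Longrightarrow> ball_shell_vol r s < shell_vol r s"
    using ball_shell_vol_less_shell_vol_rectangle[OF y] by metis
  define W where "W s = ennreal (p * s powr (p - 1)) * indicator {0<..} s" for s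
  define A where "A v = (\<integral>\<^sup>+s. W s * ball_shell_vol (sqrt (2 * v)) s \<partial>lborel)" for v
  define C where "C v = (\<integral>\<^sup>+s. W s * shell_vol (sqrt (2 * v)) s \<partial>lborel)" for v
  define E :: "real \<Rightarrow> ennreal" where "E v = ennreal (exp (- v)) * indicator {0<..} v" for v
  have [measurable]: "E \<in> borel_measurable borel" "W \<in> borel_measurable borel"
    unfolding E_def W_def by measurable
  have [measurable]: "A \<in> borel_measurable borel" "C \<in> borel_measurable borel"
    unfolding A_def C_def by measurable
  have AC: "A v \<le> C v" if "0 < v" for v
    unfolding A_def C_def
    by (intro nn_integral_mono) (use that in \<open>auto simp: W_def indicator_def intro!: mult_left_mono ball_shell_vol_le_shell_vol\<close>)
  have A_fin: "A v < \<infinity>" if "0 < v" for v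
    using nn_integral_ball_shell_vol[OF p, of "sqrt (2 * v)"] that by (simp add: A_def W_def mult_ac)
  have AC_strict: "A v < C v" if v: "r1\<^sup>2 / 2 < v" "v < r2\<^sup>2 / 2" for v
    unfolding A_def C_def
  proof (rule nn_integral_strict_mono_interval[OF _ _ _ _ s(2)])
    have v0: "0 < v" using v zero_le_power2[of r1] by linarith
    show "(\<integral>\<^sup>+s. W s * ball_shell_vol (sqrt (2 * v)) s \<partial>lborel) \<noteq> \<infinity>"
      using A_fin[OF v0] by (simp add: A_def)
    show "W s * ball_shell_vol (sqrt (2 * v)) s \<le> W s * shell_vol (sqrt (2 * v)) s" for s
      using v0 by (auto simp: W_def indicator_def intro!: mult_left_mono ball_shell_vol_le_shell_vol)
    fix t assume t: "s1 < t" "t < s2"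
    have "r1 < sqrt (2 * v)" "sqrt (2 * v) < r2"
      using v r by (auto intro!: real_less_rsqrt real_less_lsqrt simp: v0 less_imp_le)
    hence "ball_shell_vol (sqrt (2 * v)) t < shell_vol (sqrt (2 * v)) t" using t by (intro less)
    moreover have "W t = ennreal (p * t powr (p - 1))" "0 < p * t powr (p - 1)"
      using t s p by (auto simp: W_def)
    ultimately show "W t * ball_shell_vol (sqrt (2 * v)) t < W t * shell_vol (sqrt (2 * v)) t"
      by (auto intro!: ennreal_mult_strict_left_mono)
  qed measurable
  have "(\<integral>\<^sup>+v. E v * A v \<partial>lborel) < (\<integral>\<^sup>+v. E v * C v \<partial>lborel)"
  proof (rule nn_integral_strict_mono_interval)
    show "(\<integral>\<^sup>+v. E v * A v \<partial>lborel) \<noteq> \<infinity>"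
      using ball_shell_vol_integral[OF p] by (simp add: E_def A_def W_def mult_ac)
    show "E v * A v \<le> E v * C v" for v
      using AC[of v] by (auto simp: E_def indicator_def intro!: mult_left_mono)
    show "r1\<^sup>2 / 2 < r2\<^sup>2 / 2" using r by (simp add: power_strict_mono)
    fix v assume v: "r1\<^sup>2 / 2 < v" "v < r2\<^sup>2 / 2"
    have "0 < v" using v zero_le_power2[of r1] by linarith
    thus "E v * A v < E v * C v"
      using AC_strict[OF v] by (auto simp: E_def intro!: ennreal_mult_strict_left_mono)
  qed measurable
  thus ?thesis
    unfolding exp_moment_eq_shell_vol_integral[OF p] ball_shell_vol_integral[OF p, symmetric]
    by (simp add: E_def A_def C_def W_def mult_ac)
qed

text \<open>
  A homogeneous function is determined by its unit body, and the radius of a ball is determined by its volume.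
\<close>
lemma sublevel_eq_ball_iff: "(\<exists>r>0. {x. N x \<le> 1} = cball 0 r) \<longleftrightarrow> (\<forall>x. N x = norm x / radius)"
proof
  assume "\<exists>r>0. {x. N x \<le> 1} = cball 0 r"
  then obtain r where r: "0 < r" and eq: "{x. N x \<le> 1} = cball 0 r" by blast
  have iff: "N x \<le> 1 \<longleftrightarrow> norm x \<le> r" for x
    using eq by (auto simp: set_eq_iff)
  have "vol = unit_ball_vol DIM('a) * r ^ DIM('a)"
    unfolding vol_def eq using r by (simp add: content_cball)
  hence "radius = (r powr DIM('a)) powr (1 / DIM('a))"
    using r by (simp add: radius_def powr_realpow)
  hence radius: "radius = r" using r by (simp add: powr_powr)
  show "\<forall>x. N x = norm x / radius"
  proof
    fix x
    show "N x = norm x / radius"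
    proof (cases "x = 0")
      case False
      have N: "0 < N x" using nonneg[of x] definite[of x] False by fastforce
      have "N ((r / norm x) *\<^sub>R x) \<le> 1" unfolding iff using False r by simp
      moreover have "norm ((1 / N x) *\<^sub>R x) \<le> r" unfolding iff[symmetric] homogeneous using N by simp
      ultimately show ?thesis
        using False N r by (simp add: homogeneous radius field_simps)
    qed simp
  qed
next
  assume *: "\<forall>x. N x = norm x / radius"
  hence "{x. N x \<le> 1} = cball 0 radius"
    using radius_pos by auto
  thus "\<exists>r>0. {x. N x \<le> 1} = cball 0 r" using radius_pos by blast
qed

end

lemma star_gauge_norm: "star_gauge (norm :: 'a::euclidean_space \<Rightarrow> real)"
  by unfold_locales (auto intro: continuous_intros)

context star_gauge
begin

lemma le_norm: "\<exists>K\<ge>0. \<forall>x. N x \<le> K * norm x"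
proof -
  obtain K where "0 \<le> K" and K: "\<And>x. x \<in> sphere 0 1 \<Longrightarrow> N x \<le> K"
  proof -
    have "compact (N ` sphere 0 1)"
      using continuous continuous_on_subset compact_sphere by (intro compact_continuous_image) blast+
    then obtain K where "\<And>x. x \<in> sphere 0 1 \<Longrightarrow> norm (N x) \<le> K"
      using compact_imp_bounded bounded_iff by (metis image_eqI)
    thus ?thesis by (intro that[of "max 0 K"]) (auto simp: le_max_iff_disj nonneg)
  qed
  have "N x \<le> K * norm x" for x
  proof (cases "x = 0")
    case False
    have "N x = norm x * N (x /\<^sub>R norm x)"
      using homogeneous[of "norm x" "x /\<^sub>R norm x"] False by simp
    also have "\<dots> \<le> norm x * K" using False by (intro mult_left_mono K) simp_all
    finally show ?thesis by (simp add: mult.commute)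
  qed simp
  with \<open>0 \<le> K\<close> show ?thesis by blast
qed

text \<open>
  By compactness of the sphere \<open>N\<close> is dominated by a multiple of the Euclidean norm, whose moment is the explicit
  value of the equality case.
\<close>
lemma exp_moment_finite:
  assumes p: "0 < p"
  shows "exp_moment p < \<infinity>"
proof -
  interpret E: star_gauge "norm :: 'a \<Rightarrow> real" by (rule star_gauge_norm)
  have "{x::'a. norm x \<le> 1} = cball 0 1" by auto
  hence "\<exists>r>0. {x::'a. norm x \<le> 1} = cball 0 r" by (intro exI[of _ 1]) simp
  hence fin: "E.exp_moment p < \<infinity>"
    unfolding E.sublevel_eq_ball_iff by (subst E.exp_moment_ball[OF p]) auto
  obtain K where K: "0 \<le> K" "\<And>x. N x \<le> K * norm x" using le_norm by blast
  have le: "N x powr p \<le> K powr p * norm x powr p" for x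
    using powr_mono2[OF _ nonneg K(2), of p] p K(1) by (simp add: powr_mult)
  have "exp_moment p \<le> (\<integral>\<^sup>+x. ennreal (K powr p) * ennreal (exp (- (norm (x::'a))\<^sup>2 / 2) * norm x powr p) \<partial>lborel)"
    by (intro nn_integral_mono) (use le in \<open>simp add: ennreal_mult'[symmetric] mult.left_commute[of "K powr p"]\<close>)
  also have "\<dots> = ennreal (K powr p) * E.exp_moment p"
    by (rule nn_integral_cmult) simp
  also have "\<dots> < \<infinity>" using fin by (simp add: ennreal_mult_less_top)
  finally show ?thesis .
qed

end

section \<open>Absolute moments as Gaussian moments of the gauge\<close>

definition gauss :: "'a::euclidean_space \<Rightarrow> real" where
  "gauss x = (2 * pi) powr (- real DIM('a) / 2) * exp (- (norm x)\<^sup>2 / 2)"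

lemma gauss_nonneg [simp]: "0 \<le> gauss x"
  by (simp add: gauss_def)

lemma measurable_gauss [measurable]: "gauss \<in> borel_measurable borel"
  unfolding gauss_def by measurable

lemma gauss_eq_prod: "gauss x = (\<Prod>b\<in>Basis. std_normal_density (x \<bullet> b))" for x :: "'a::euclidean_space"
proof -
  have "(norm x)\<^sup>2 = (\<Sum>b\<in>Basis. (x \<bullet> b)\<^sup>2)"
    unfolding power2_norm_eq_inner by (subst euclidean_inner) (simp add: power2_eq_square)
  hence "exp (- (norm x)\<^sup>2 / 2) = (\<Prod>b\<in>Basis. exp (- (x \<bullet> b)\<^sup>2 / 2))"
    by (simp add: exp_sum[symmetric] sum_negf sum_divide_distrib)
  moreover have "(2 * pi) powr (- real DIM('a) / 2) = (1 / sqrt (2 * pi)) ^ DIM('a)"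
  proof -
    have "1 / sqrt (2 * pi) = (2 * pi) powr (- (1 / 2))"
      by (simp add: powr_minus powr_half_sqrt field_simps)
    thus ?thesis by (simp add: powr_realpow[symmetric] powr_powr)
  qed
  ultimately show ?thesis
    by (simp add: gauss_def std_normal_density_def prod_dividef power_divide)
qed

lemma nn_integral_gauss: "(\<integral>\<^sup>+x. ennreal (gauss x) \<partial>lborel) = 1"
proof -
  have "(\<integral>\<^sup>+x. ennreal (std_normal_density x) \<partial>lborel) = 1"
    using prob_space.emeasure_space_1[OF prob_space_normal_density[of 1 0]]
    by (simp add: emeasure_density)
  thus ?thesis
    unfolding gauss_eq_prod prod_ennreal[OF normal_density_nonneg, symmetric]
    by (subst nn_integral_lborel_prod) auto
qed

lemma integrable_gauss: "integrable lborel gauss"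
  by (rule integrableI_nonneg) (auto simp: nn_integral_gauss)

lemma integral_gauss: "integral\<^sup>L lborel gauss = 1"
  by (subst integral_eq_nn_integral) (auto simp: nn_integral_gauss)

text \<open>
  The Gaussian density is a product over the coordinates, so the integral factorises into one-dimensional
  characteristic functions.
\<close>
lemma gauss_fourier:
  fixes y :: "'a::euclidean_space"
  shows "(CLINT x|lborel. complex_of_real (gauss x) * iexp (y \<bullet> x)) = complex_of_real (exp (- (norm y)\<^sup>2 / 2))"
proof -
  interpret product_sigma_finite "\<lambda>_::'a. lborel :: real measure" by standard
  let ?T = "\<lambda>f::'a \<Rightarrow> real. \<Sum>b\<in>Basis. f b *\<^sub>R b"
  define g where "g b t = complex_of_real (std_normal_density t) * iexp ((y \<bullet> b) * t)" for b :: 'a and t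
  have int: "integrable lborel (g b)" for b
  proof (rule Bochner_Integration.integrable_bound)
    show "integrable lborel std_normal_density" by simp
    show "AE t in lborel. norm (g b t) \<le> norm (std_normal_density t)"
      by (auto simp: g_def norm_mult)
  qed (simp add: g_def[abs_def])
  have val: "(CLINT t|lborel. g b t) = complex_of_real (exp (- (y \<bullet> b)\<^sup>2 / 2))" for b
  proof -
    have "(CLINT t|lborel. g b t) = char std_normal_distribution (y \<bullet> b)"
      unfolding char_def g_def
      by (subst integral_density) (auto simp: scaleR_conv_of_real)
    thus ?thesis by (simp add: char_std_normal_distribution)
  qed
  have T: "?T f \<bullet> b = f b" if "b \<in> Basis" for f b
    using that by simp
  have gT: "complex_of_real (gauss (?T f)) * iexp (y \<bullet> ?T f) = (\<Prod>b\<in>Basis. g b (f b))" for f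
  proof -
    have "y \<bullet> ?T f = (\<Sum>b\<in>Basis. (y \<bullet> b) * f b)"
      by (simp add: inner_sum_right mult.commute)
    hence "iexp (y \<bullet> ?T f) = (\<Prod>b\<in>Basis. iexp ((y \<bullet> b) * f b))"
      by (simp add: sum_distrib_left exp_sum[symmetric])
    moreover have "gauss (?T f) = (\<Prod>b\<in>Basis. std_normal_density (f b))"
      unfolding gauss_eq_prod by (intro prod.cong) (simp_all only: T)
    ultimately show ?thesis
      by (simp add: g_def prod.distrib)
  qed
  have "(CLINT x|lborel. complex_of_real (gauss x) * iexp (y \<bullet> x))
      = (CLINT f|(\<Pi>\<^sub>M b\<in>Basis. lborel). complex_of_real (gauss (?T f)) * iexp (y \<bullet> ?T f))"
    by (subst lborel_eq, subst integral_distr) simp_all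
  also have "\<dots> = (\<Prod>b\<in>Basis. (CLINT t|lborel. g b t))"
    unfolding gT by (rule product_integral_prod) (simp_all add: int)
  also have "\<dots> = complex_of_real (\<Prod>b\<in>Basis. exp (- (y \<bullet> b)\<^sup>2 / 2))"
    by (simp add: val)
  also have "(\<Prod>b\<in>Basis. exp (- (y \<bullet> b)\<^sup>2 / 2)) = exp (- (norm y)\<^sup>2 / 2)"
  proof -
    have "(norm y)\<^sup>2 = (\<Sum>b\<in>Basis. (y \<bullet> b)\<^sup>2)"
      unfolding power2_norm_eq_inner by (subst euclidean_inner) (simp add: power2_eq_square)
    thus ?thesis by (simp add: exp_sum[symmetric] sum_negf sum_divide_distrib)
  qed
  finally show ?thesis .
qed

text \<open>
  Integrating the characteristic function of \<open>X\<close> at \<open>t *\<^sub>R x\<close> against the Gaussian density in \<open>x\<close>: exchanging the two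
  integrals leaves the Gaussian characteristic function at \<open>t *\<^sub>R X \<omega>\<close>.
\<close>
lemma gaussian_subordination:
  fixes X :: "'b \<Rightarrow> 'a::euclidean_space"
  assumes "prob_space M" and [measurable]: "X \<in> borel_measurable M" "\<phi> \<in> borel_measurable borel"
    and char: "\<And>u. (CLINT \<omega>|M. iexp (X \<omega> \<bullet> u)) = complex_of_real (\<phi> u)"
  shows "(LINT \<omega>|M. exp (- (t\<^sup>2 * ((norm (X \<omega>))\<^sup>2 / 2)))) = (LINT x|lborel. gauss x * \<phi> (t *\<^sub>R x))"
proof -
  interpret prob_space M by fact
  interpret pair_sigma_finite M "lborel :: 'a measure" by standard
  let ?f = "\<lambda>\<omega> x. complex_of_real (gauss x) * iexp (X \<omega> \<bullet> (t *\<^sub>R x))"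
  have int: "integrable (M \<Otimes>\<^sub>M lborel) (case_prod ?f)"
  proof (rule integrableI_bounded)
    have "(\<integral>\<^sup>+z. ennreal (norm (case_prod ?f z)) \<partial>(M \<Otimes>\<^sub>M lborel)) = (\<integral>\<^sup>+\<omega>. \<integral>\<^sup>+x. ennreal (gauss (x::'a)) \<partial>lborel \<partial>M)"
      by (subst lborel.nn_integral_fst[symmetric]) (auto simp: norm_mult)
    thus "(\<integral>\<^sup>+z. ennreal (norm (case_prod ?f z)) \<partial>(M \<Otimes>\<^sub>M lborel)) < \<infinity>"
      by (simp add: nn_integral_gauss emeasure_space_1)
  qed measurable
  have "complex_of_real (LINT \<omega>|M. exp (- (t\<^sup>2 * ((norm (X \<omega>))\<^sup>2 / 2)))) = (CLINT \<omega>|M. CLINT x|lborel. ?f \<omega> x)"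
    unfolding integral_complex_of_real[symmetric]
  proof (intro Bochner_Integration.integral_cong refl)
    fix \<omega>
    have "(CLINT x|lborel. ?f \<omega> x) = (CLINT x|lborel. complex_of_real (gauss x) * iexp ((t *\<^sub>R X \<omega>) \<bullet> x))"
      by simp
    also have "\<dots> = complex_of_real (exp (- (norm (t *\<^sub>R X \<omega>))\<^sup>2 / 2))"
      by (rule gauss_fourier)
    finally show "complex_of_real (exp (- (t\<^sup>2 * ((norm (X \<omega>))\<^sup>2 / 2)))) = (CLINT x|lborel. ?f \<omega> x)"
      by (simp add: power_mult_distrib)
  qed
  also have "\<dots> = (CLINT x|lborel. CLINT \<omega>|M. ?f \<omega> x)"
    by (rule Fubini_integral[OF int, symmetric])
  also have "\<dots> = (CLINT x|lborel. complex_of_real (gauss x * \<phi> (t *\<^sub>R x)))"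
    by (intro Bochner_Integration.integral_cong refl, subst integral_mult_right_zero, subst char) simp
  also have "\<dots> = complex_of_real (LINT x|lborel. gauss x * \<phi> (t *\<^sub>R x))"
    by (rule integral_complex_of_real)
  finally show ?thesis by (simp only: of_real_eq_iff)
qed

text \<open>
  One minus each side of \<open>gaussian_subordination\<close> is integrated against \<open>t powr (- 1 - p)\<close>. Subtracting from one
  makes the integrand nonnegative and small at \<open>t = 0\<close>, so that all exchanges of integrals are
  between nonnegative functions and no moment has to be known to be finite beforehand.
\<close>
lemma (in star_gauge) absolute_moment_eq_gaussian_moment:
  fixes X :: "'b \<Rightarrow> 'a" and \<alpha> p :: real
  assumes "prob_space M" and [measurable]: "X \<in> borel_measurable M"
    and char: "\<And>u. (CLINT \<omega>|M. iexp (X \<omega> \<bullet> u)) = complex_of_real (exp (- (N u powr \<alpha>)))"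
    and p: "0 < p" "p < \<alpha>" "\<alpha> \<le> 2"
  shows "ennreal (Gamma (1 - p / 2)) * (\<integral>\<^sup>+\<omega>. ennreal (norm (X \<omega>) powr p) \<partial>M)
       = ennreal (2 powr (p / 2) * Gamma (1 - p / \<alpha>) * (2 * pi) powr (- real DIM('a) / 2)) * exp_moment p"
proof -
  interpret prob_space M by fact
  define w :: "real \<Rightarrow> ennreal" where "w t = ennreal (t powr (- 1 - p)) * indicator {0<..} t" for t
  have [measurable]: "w \<in> borel_measurable borel" unfolding w_def by measurable
  have G2: "0 < Gamma (1 - p / 2)" and Ga: "0 < Gamma (1 - p / \<alpha>)"
    using p by (auto intro!: Gamma_real_pos)
  \<comment> \<open>The weight \<open>w\<close> restricts to \<open>t > 0\<close>, where homogeneity of \<open>N\<close> turns \<open>N (t x)\<close> into \<open>t N x\<close>.\<close>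
  have exch: "w t * (\<integral>\<^sup>+\<omega>. ennreal (1 - exp (- (t\<^sup>2 * ((norm (X \<omega>))\<^sup>2 / 2)))) \<partial>M)
     = w t * (\<integral>\<^sup>+x. ennreal (gauss x * (1 - exp (- (t powr \<alpha> * N x powr \<alpha>)))) \<partial>lborel)" for t
  proof (cases "0 < t")
    case True
    let ?\<phi> = "\<lambda>u. exp (- (N u powr \<alpha>))"
    have N: "N (t *\<^sub>R x) powr \<alpha> = t powr \<alpha> * N x powr \<alpha>" for x
      using True nonneg[of x] by (simp add: homogeneous powr_mult)
    have int1: "integrable M (\<lambda>\<omega>. exp (- (t\<^sup>2 * ((norm (X \<omega>))\<^sup>2 / 2))))"
      by (rule integrable_const_bound[of _ 1]) auto
    have int2: "integrable lborel (\<lambda>x. gauss x * ?\<phi> (t *\<^sub>R x))"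
      by (rule Bochner_Integration.integrable_bound[OF integrable_gauss]) (auto intro!: mult_left_le)
    have "(\<integral>\<^sup>+\<omega>. ennreal (1 - exp (- (t\<^sup>2 * ((norm (X \<omega>))\<^sup>2 / 2)))) \<partial>M)
        = ennreal (LINT \<omega>|M. 1 - exp (- (t\<^sup>2 * ((norm (X \<omega>))\<^sup>2 / 2))))"
      using int1 by (intro nn_integral_eq_integral) auto
    also have "(LINT \<omega>|M. 1 - exp (- (t\<^sup>2 * ((norm (X \<omega>))\<^sup>2 / 2)))) = 1 - (LINT x|lborel. gauss x * ?\<phi> (t *\<^sub>R x))"
      using int1 gaussian_subordination[of M X ?\<phi> t] prob_space_axioms char by (simp add: prob_space)
    also have "\<dots> = (LINT x|lborel. gauss x - gauss x * ?\<phi> (t *\<^sub>R x))"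
      by (simp only: Bochner_Integration.integral_diff[OF integrable_gauss int2] integral_gauss)
    also have "ennreal \<dots> = (\<integral>\<^sup>+x. ennreal (gauss x - gauss x * ?\<phi> (t *\<^sub>R x)) \<partial>lborel)"
      using int2 integrable_gauss by (intro nn_integral_eq_integral[symmetric]) (auto intro!: mult_left_le)
    finally show ?thesis by (simp add: N right_diff_distrib)
  qed (simp add: w_def)
  have left: "(\<integral>\<^sup>+t. w t * ennreal (1 - exp (- (t\<^sup>2 * ((norm (X \<omega>))\<^sup>2 / 2)))) \<partial>lborel)
      = ennreal (2 powr (- (p / 2)) * Gamma (1 - p / 2) / p) * ennreal (norm (X \<omega>) powr p)" for \<omega>
  proof -
    have "(\<integral>\<^sup>+t. w t * ennreal (1 - exp (- (t\<^sup>2 * ((norm (X \<omega>))\<^sup>2 / 2)))) \<partial>lborel)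
       = (\<integral>\<^sup>+t\<in>{0<..}. ennreal (t powr (- 1 - p)) * ennreal (1 - exp (- (t powr 2 * ((norm (X \<omega>))\<^sup>2 / 2)))) \<partial>lborel)"
      by (intro nn_integral_cong) (auto simp: w_def indicator_def)
    also have "\<dots> = ennreal (((norm (X \<omega>))\<^sup>2 / 2) powr (p / 2) * Gamma (1 - p / 2) / p)"
      using p by (intro nn_integral_one_minus_exp_powr) auto
    also have "((norm (X \<omega>))\<^sup>2 / 2) powr (p / 2) = 2 powr (- (p / 2)) * norm (X \<omega>) powr p"
    proof (cases "X \<omega> = 0")
      case False
      hence "((norm (X \<omega>))\<^sup>2) powr (p / 2) = norm (X \<omega>) powr p"
        by (simp add: powr_powr flip: powr_numeral)
      thus ?thesis by (simp add: powr_divide powr_minus field_simps)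
    qed (use p in simp)
    finally show ?thesis using p G2 by (simp add: ennreal_mult'[symmetric] mult_ac)
  qed
  have right: "(\<integral>\<^sup>+t. w t * ennreal (gauss x * (1 - exp (- (t powr \<alpha> * N x powr \<alpha>)))) \<partial>lborel)
      = ennreal (Gamma (1 - p / \<alpha>) / p * (2 * pi) powr (- real DIM('a) / 2)) * ennreal (exp (- (norm x)\<^sup>2 / 2) * N x powr p)" for x
  proof -
    have "(\<integral>\<^sup>+t. w t * ennreal (gauss x * (1 - exp (- (t powr \<alpha> * N x powr \<alpha>)))) \<partial>lborel)
       = (\<integral>\<^sup>+t. ennreal (gauss x) * (ennreal (t powr (- 1 - p)) * ennreal (1 - exp (- (t powr \<alpha> * N x powr \<alpha>))) * indicator {0<..} t) \<partial>lborel)"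
      by (intro nn_integral_cong) (simp add: w_def ennreal_mult' mult_ac)
    also have "\<dots> = ennreal (gauss x) * ennreal ((N x powr \<alpha>) powr (p / \<alpha>) * Gamma (1 - p / \<alpha>) / p)"
      using p by (subst nn_integral_cmult, simp, subst nn_integral_one_minus_exp_powr) auto
    also have "(N x powr \<alpha>) powr (p / \<alpha>) = N x powr p"
      using p by (simp add: powr_powr)
    finally show ?thesis using p Ga by (simp add: gauss_def ennreal_mult'[symmetric] mult_ac)
  qed
  have "ennreal (2 powr (- (p / 2)) * Gamma (1 - p / 2) / p) * (\<integral>\<^sup>+\<omega>. ennreal (norm (X \<omega>) powr p) \<partial>M)
     = (\<integral>\<^sup>+\<omega>. \<integral>\<^sup>+t. w t * ennreal (1 - exp (- (t\<^sup>2 * ((norm (X \<omega>))\<^sup>2 / 2)))) \<partial>lborel \<partial>M)"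
    unfolding left by (rule nn_integral_cmult[symmetric]) simp
  also have "\<dots> = (\<integral>\<^sup>+t. w t * (\<integral>\<^sup>+\<omega>. ennreal (1 - exp (- (t\<^sup>2 * ((norm (X \<omega>))\<^sup>2 / 2)))) \<partial>M) \<partial>lborel)"
  proof -
    interpret pair_sigma_finite "lborel :: real measure" M by standard
    show ?thesis by (subst Fubini') (simp_all add: nn_integral_cmult)
  qed
  also have "\<dots> = (\<integral>\<^sup>+t. \<integral>\<^sup>+x. w t * ennreal (gauss x * (1 - exp (- (t powr \<alpha> * N x powr \<alpha>)))) \<partial>lborel \<partial>lborel)"
    unfolding exch by (simp add: nn_integral_cmult)
  also have "\<dots> = (\<integral>\<^sup>+x. \<integral>\<^sup>+t. w t * ennreal (gauss x * (1 - exp (- (t powr \<alpha> * N x powr \<alpha>)))) \<partial>lborel \<partial>lborel)"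
    by (rule lborel_pair.Fubini') measurable
  also have "\<dots> = ennreal (Gamma (1 - p / \<alpha>) / p * (2 * pi) powr (- real DIM('a) / 2)) * exp_moment p"
    unfolding right by (rule nn_integral_cmult) measurable
  finally have *: "ennreal (2 powr (- (p / 2)) * Gamma (1 - p / 2) / p) * (\<integral>\<^sup>+\<omega>. ennreal (norm (X \<omega>) powr p) \<partial>M)
    = ennreal (Gamma (1 - p / \<alpha>) / p * (2 * pi) powr (- real DIM('a) / 2)) * exp_moment p" .
  have "ennreal (Gamma (1 - p / 2)) = ennreal (2 powr (p / 2) * p) * ennreal (2 powr (- (p / 2)) * Gamma (1 - p / 2) / p)"
    using p G2 by (simp add: ennreal_mult'[symmetric] powr_minus field_simps)
  hence "ennreal (Gamma (1 - p / 2)) * (\<integral>\<^sup>+\<omega>. ennreal (norm (X \<omega>) powr p) \<partial>M)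
      = ennreal (2 powr (p / 2) * p) * (ennreal (Gamma (1 - p / \<alpha>) / p * (2 * pi) powr (- real DIM('a) / 2)) * exp_moment p)"
    by (simp only: * mult.assoc)
  also have "\<dots> = ennreal (2 powr (p / 2) * p) * ennreal (Gamma (1 - p / \<alpha>) / p * (2 * pi) powr (- real DIM('a) / 2)) * exp_moment p"
    by (simp only: mult.assoc)
  also have "ennreal (2 powr (p / 2) * p) * ennreal (Gamma (1 - p / \<alpha>) / p * (2 * pi) powr (- real DIM('a) / 2))
    = ennreal (2 powr (p / 2) * Gamma (1 - p / \<alpha>) * (2 * pi) powr (- real DIM('a) / 2))"
    using p Ga by (simp add: ennreal_mult'[symmetric])
  finally show ?thesis .
qed

section \<open>Moments of symmetric stable vectors\<close>

text \<open>
  Continuity is dominated convergence on the sphere. Full dimension enters for definiteness: a nonzero \<open>x\<close> of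
  stable norm zero would force the spectral measure to be concentrated on the hyperplane orthogonal to \<open>x\<close>.
\<close>
lemma star_gauge_stable_norm:
  fixes \<sigma> :: "'a::euclidean_space measure"
  assumes \<alpha>: "0 < \<alpha>" and "finite_measure \<sigma>"
    and sets: "sets \<sigma> = sets (restrict_space borel (sphere 0 1))"
    and full: "full_dimensional \<sigma>"
  shows "star_gauge (stable_norm \<alpha> \<sigma>)"
proof -
  interpret finite_measure \<sigma> by fact
  have space: "space \<sigma> = sphere 0 1"
    using sets_eq_imp_space_eq[OF sets] by (simp add: space_restrict_space)
  have [measurable]: "(\<lambda>z. z) \<in> borel_measurable \<sigma>"
    unfolding measurable_cong_sets[OF sets refl] by (intro measurable_restrict_space1) simp
  define I where "I u = (\<integral>z. \<bar>u \<bullet> z\<bar> powr \<alpha> \<partial>\<sigma>)" for u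
  have stable_norm: "stable_norm \<alpha> \<sigma> u = I u powr (1 / \<alpha>)" for u
    by (simp add: stable_norm_def I_def)
  have bound: "\<bar>u \<bullet> z\<bar> powr \<alpha> \<le> norm u powr \<alpha>" if "z \<in> space \<sigma>" for u z
    using Cauchy_Schwarz_ineq2[of u z] that \<alpha> by (intro powr_mono2) (auto simp: space)
  have integrable: "integrable \<sigma> (\<lambda>z. \<bar>u \<bullet> z\<bar> powr \<alpha>)" for u
    by (rule integrable_const_bound[of _ "norm u powr \<alpha>"]) (auto simp: bound intro!: AE_I2)
  have I_nonneg: "0 \<le> I u" for u by (simp add: I_def)
  have "continuous_on UNIV I"
    unfolding continuous_on_sequentially
  proof (intro ballI allI impI, elim conjE)
    fix u and X :: "nat \<Rightarrow> 'a"
    assume X: "X \<longlonglongrightarrow> u"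
    then obtain K where K: "\<And>n. norm (X n) \<le> K"
      using convergent_imp_Bseq[of X] by (auto simp: convergent_def Bseq_def)
    have lim: "(\<lambda>n. \<bar>X n \<bullet> z\<bar> powr \<alpha>) \<longlonglongrightarrow> \<bar>u \<bullet> z\<bar> powr \<alpha>" for z
      using X \<alpha> by (intro tendsto_powr' tendsto_intros) auto
    have dom: "\<bar>X n \<bullet> z\<bar> powr \<alpha> \<le> K powr \<alpha>" if "z \<in> space \<sigma>" for n z
      using bound[OF that, of "X n"] powr_mono2[of \<alpha>, OF _ _ K[of n]] \<alpha> by (meson less_imp_le norm_ge_zero order_trans)
    show "(I \<circ> X) \<longlonglongrightarrow> I u"
      unfolding I_def comp_def
      by (rule integral_dominated_convergence[where w = "\<lambda>_. K powr \<alpha>"]) (auto intro!: AE_I2 lim dom)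
  qed
  hence "continuous_on UNIV (stable_norm \<alpha> \<sigma>)"
    unfolding stable_norm[abs_def] using \<alpha> I_nonneg by (intro continuous_on_powr' continuous_intros) auto
  moreover have "stable_norm \<alpha> \<sigma> (t *\<^sub>R x) = \<bar>t\<bar> * stable_norm \<alpha> \<sigma> x" for t x
  proof -
    have "I (t *\<^sub>R x) = \<bar>t\<bar> powr \<alpha> * I x"
      by (simp add: I_def abs_mult powr_mult)
    thus ?thesis using \<alpha> I_nonneg by (simp add: stable_norm powr_mult powr_powr)
  qed
  moreover have "x = 0" if "stable_norm \<alpha> \<sigma> x = 0" for x
  proof (rule ccontr)
    assume x: "x \<noteq> 0"
    have "I x = 0" using that by (simp add: stable_norm)
    hence "AE z in \<sigma>. \<bar>x \<bullet> z\<bar> powr \<alpha> = 0"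
      unfolding I_def using integrable by (subst (asm) integral_nonneg_eq_0_iff_AE) auto
    hence "AE z in \<sigma>. z \<notin> sphere 0 1 - {z. x \<bullet> z = 0}" by eventually_elim simp
    moreover have eq: "sphere 0 1 - {z. x \<bullet> z = 0} = {z \<in> space \<sigma>. x \<bullet> z \<noteq> 0}" by (auto simp: space)
    moreover have "{z \<in> space \<sigma>. x \<bullet> z \<noteq> 0} \<in> sets \<sigma>" by measurable
    ultimately have "emeasure \<sigma> (sphere 0 1 - {z. x \<bullet> z = 0}) = 0"
      using AE_iff_measurable[of "sphere 0 1 - {z. x \<bullet> z = 0}" \<sigma> "\<lambda>z. z \<notin> sphere 0 1 - {z. x \<bullet> z = 0}"]
      by (auto simp: space)
    with full x show False
      unfolding full_dimensional_def using subspace_hyperplane[of x] dim_hyperplane[of x] by blast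
  qed
  ultimately show ?thesis
    by unfold_locales (simp_all add: stable_norm)
qed

theorem corollary6p4:
  fixes \<alpha> p :: real
    and M :: "'b measure"
    and \<xi> :: "'b \<Rightarrow> 'a::euclidean_space"
    and \<sigma> :: "'a measure"
    and F :: "'a set"
  defines "F \<equiv> star_body \<alpha> \<sigma>"
  assumes "0 < \<alpha>" and "\<alpha> \<le> 2"
    and "symmetric_stable \<alpha> M \<xi>"
    and "is_spectral_measure \<alpha> M \<xi> \<sigma>"
    and "full_dimensional \<sigma>"
    and "0 < p" and "p < \<alpha>"
  shows "(LINT \<omega>|M. norm (\<xi> \<omega>) powr p) \<ge>
           2 powr p * (Gamma ((DIM('a) + p) / 2) / Gamma (DIM('a) / 2))
           * (Gamma (1 - p / \<alpha>) / Gamma (1 - p / 2))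
           * (unit_ball_vol DIM('a) / measure lborel F) powr (p / DIM('a))
       \<and> ((LINT \<omega>|M. norm (\<xi> \<omega>) powr p) =
           2 powr p * (Gamma ((DIM('a) + p) / 2) / Gamma (DIM('a) / 2))
           * (Gamma (1 - p / \<alpha>) / Gamma (1 - p / 2))
           * (unit_ball_vol DIM('a) / measure lborel F) powr (p / DIM('a))
         \<longleftrightarrow> (\<exists>r>0. F = cball 0 r))"
proof -
  have \<xi>: "prob_space M" "\<xi> \<in> borel_measurable M"
    using assms by (simp_all add: symmetric_stable_def)
  interpret prob_space M by fact
  interpret star_gauge "stable_norm \<alpha> \<sigma>"
    using assms by (intro star_gauge_stable_norm) (simp_all add: is_spectral_measure_def)
  let ?d = "real DIM('a)" and ?N = "stable_norm \<alpha> \<sigma>"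
  have F: "F = {x. ?N x \<le> 1}" by (simp add: F_def star_body_def)
  have radius_powr: "radius powr (- p) = (unit_ball_vol ?d / measure lborel F) powr (p / ?d)"
    using vol_pos by (simp add: F vol_def[symmetric] radius_def powr_powr powr_divide powr_minus field_simps)
  have G2: "0 < Gamma (1 - p / 2)" and Ga: "0 < Gamma (1 - p / \<alpha>)"
    using assms by (auto intro!: Gamma_real_pos)
  \<comment> \<open>The constant for which the moment of \<open>\<xi>\<close> is \<open>c\<close> times the unnormalised Gaussian moment of the gauge.\<close>
  define c where "c = 2 powr (p / 2) * Gamma (1 - p / \<alpha>) * (2 * pi) powr (- ?d / 2) / Gamma (1 - p / 2)"
  have c: "0 < c" using G2 Ga by (simp add: c_def)
  define J where "J = enn2real (exp_moment p)"
  have J: "exp_moment p = ennreal J" "0 \<le> J"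
    using exp_moment_finite[OF \<open>0 < p\<close>] by (simp_all add: J_def)
  have "(\<integral>\<^sup>+\<omega>. ennreal (norm (\<xi> \<omega>) powr p) \<partial>M) = ennreal (c * J)"
  proof -
    have "ennreal (Gamma (1 - p / 2)) * (\<integral>\<^sup>+\<omega>. ennreal (norm (\<xi> \<omega>) powr p) \<partial>M)
        = ennreal (2 powr (p / 2) * Gamma (1 - p / \<alpha>) * (2 * pi) powr (- ?d / 2)) * ennreal J"
      unfolding J(1)[symmetric]
      by (rule absolute_moment_eq_gaussian_moment) (use assms \<xi> in \<open>simp_all add: is_spectral_measure_def\<close>)
    also have "\<dots> = ennreal (Gamma (1 - p / 2)) * ennreal (c * J)"
      using G2 Ga J c by (simp add: ennreal_mult'[symmetric] c_def)
    finally show ?thesis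
      using G2 by (simp add: ennreal_mult_cancel_left)
  qed
  hence E: "(LINT \<omega>|M. norm (\<xi> \<omega>) powr p) = c * J"
    using \<xi> c J by (subst integral_eq_nn_integral) auto
  have bound: "c * ball_exp_moment p = 2 powr p * (Gamma ((DIM('a) + p) / 2) / Gamma (DIM('a) / 2))
           * (Gamma (1 - p / \<alpha>) / Gamma (1 - p / 2))
           * (unit_ball_vol DIM('a) / measure lborel F) powr (p / DIM('a))"
  proof -
    have "(2 * pi) powr (- ?d / 2) * (2 * pi) powr (?d / 2) = 1"
      by (simp add: powr_add[symmetric])
    moreover have "2 powr (p / 2) * 2 powr (p / 2) = 2 powr p"
      by (simp add: powr_add[symmetric])
    moreover have "c * ball_exp_moment p = (2 powr (p / 2) * 2 powr (p / 2)) * (Gamma ((?d + p) / 2) / Gamma (?d / 2))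
        * (Gamma (1 - p / \<alpha>) / Gamma (1 - p / 2)) * radius powr (- p) * ((2 * pi) powr (- ?d / 2) * (2 * pi) powr (?d / 2))"
      unfolding c_def by (simp only: times_divide_eq_left times_divide_eq_right mult_ac)
    ultimately show ?thesis by (simp only: radius_powr mult_1_right)
  qed
  have nn: "0 \<le> ball_exp_moment p"
    using \<open>0 < p\<close> by (intro mult_nonneg_nonneg divide_nonneg_nonneg) (auto intro!: less_imp_le Gamma_real_pos add_nonneg_pos)
  have "ball_exp_moment p \<le> J"
    using exp_moment_ge[OF \<open>0 < p\<close>] J by (simp add: ennreal_le_iff)
  moreover have "J = ball_exp_moment p \<longleftrightarrow> (\<forall>x. ?N x = norm x / radius)"
  proof
    assume "J = ball_exp_moment p"
    thus "\<forall>x. ?N x = norm x / radius"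
      using exp_moment_greater[OF \<open>0 < p\<close>] J(1) by force
  next
    assume "\<forall>x. ?N x = norm x / radius"
    hence "ennreal J = ennreal (ball_exp_moment p)"
      using exp_moment_ball[OF \<open>0 < p\<close>] J(1) by simp
    thus "J = ball_exp_moment p" using J(2) nn by (simp only: ennreal_inj)
  qed
  moreover have "(\<exists>r>0. F = cball 0 r) \<longleftrightarrow> (\<forall>x. ?N x = norm x / radius)"
    unfolding F by (rule sublevel_eq_ball_iff)
  moreover have "c * b \<le> c * J \<longleftrightarrow> b \<le> J" "c * J = c * b \<longleftrightarrow> J = b" for b
    using c by simp_all
  ultimately show ?thesis
    unfolding E bound[symmetric] by (simp only: simp_thms)
qed

end
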